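(* Suppose that $C$ is a bivariate copula with $\phi(C)=0$. Then $\rho(C)<\frac13$.
   Context: Let $\mathbb I=[0,1]$. A bivariate copula is a function $C:\mathbb I^2\to\mathbb I$ with $C(0,v)=C(u,0)=0$, $C(u,1)=u$, $C(1,v)=v$ for all $u,v\in\mathbb I$, and $C(u_2,v_2)-C(u_2,v_1)-C(u_1,v_2)+C(u_1,v_1)\ge 0$ whenever $0\le u_1\le u_2\le 1$, $0\le v_1\le v_2\le 1$. Spearman's rho is $\rho(C)=12\int_{\mathbb I^2}C(u,v)\,du\,dv-3$ and Spearman's footrule is $\phi(C)=6\int_0^1C(u,u)\,du-2$. *)

theory Defs
  imports "HOL-Analysis.Analysis"
begin

(* A copula is a map on the unit square; it is represented by a total function on the reals
   whose values outside [0,1] x [0,1] are unconstrained and never used below. *)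
definition copula :: "(real \<Rightarrow> real \<Rightarrow> real) \<Rightarrow> bool" where
  "copula C \<longleftrightarrow>
     (\<forall>u\<in>{0..1}. \<forall>v\<in>{0..1}. C u v \<in> {0..1}) \<and>
     (\<forall>v\<in>{0..1}. C 0 v = 0) \<and>
     (\<forall>u\<in>{0..1}. C u 0 = 0) \<and>
     (\<forall>u\<in>{0..1}. C u 1 = u) \<and>
     (\<forall>v\<in>{0..1}. C 1 v = v) \<and>
     (\<forall>u1 u2 v1 v2. 0 \<le> u1 \<and> u1 \<le> u2 \<and> u2 \<le> 1 \<and> 0 \<le> v1 \<and> v1 \<le> v2 \<and> v2 \<le> 1 \<longrightarrow>
        C u2 v2 - C u2 v1 - C u1 v2 + C u1 v1 \<ge> 0)"

(* Copulas are Lipschitz on the unit square, so both integrals below exist. *)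
definition spearman_rho :: "(real \<Rightarrow> real \<Rightarrow> real) \<Rightarrow> real" where
  "spearman_rho C = 12 * integral ({0..1} \<times> {0..1}) (\<lambda>(u, v). C u v) - 3"

definition spearman_footrule :: "(real \<Rightarrow> real \<Rightarrow> real) \<Rightarrow> real" where
  "spearman_footrule C = 6 * integral {0..1} (\<lambda>u. C u u) - 2"

end

theory Submission
  imports Defs
begin

text \<open>
Let $(U,V)$ be a random vector with distribution function $C$. Then
$\phi(C) = 1 - 3\,E|U-V|$ and $\rho(C) = 1 - 6\,E(U-V)^2$, so under $\phi(C)=0$ the claim says
that $E(U-V)^2 > 1/9 = (E|U-V|)^2$, that is, $E(|U-V| - 1/3)^2 > 0$. If this expectation
vanished, then $|U-V| = 1/3$ almost surely; so $V$ would lie in the middle third whenever $U$ lies in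
one of the two outer thirds, and an event of probability $1/3$ would contain one of
probability $2/3$.

The contradiction is made quantitative by transport duality: a function $a$ with
$a(u) + a(v) \le (|u-v| - 1/3)^2$ everywhere satisfies
$2\int_0^1 a \le E(|U-V| - 1/3)^2$, because both marginals are uniform. Take
$a = \varepsilon$ on the outer thirds with margins of width $1/24$ cut off at both ends,
$a = -\varepsilon$ on the middle third, and $a = 0$ on the margins, where
$\varepsilon = 1/24^2$. Without the margins the inequality would fail, for example at
$(0, 1/3 - \delta)$ with small $\delta$. With them
$\int_0^1 a = \varepsilon/6$, hence $E(|U-V|-1/3)^2 \ge 1/1728$.

Instead of building the measure, the proof works with the masses that $C$ gives to the
cells of an $n \times n$ grid. The sum over all cells of mass times $(n-i)(n-j)$, and that of mass
times $n - \max(i,j)$, are exactly the sums of the values of $C$ at all grid points and at the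
diagonal grid points (\<open>grid_mean_prod\<close> and \<open>grid_mean_max\<close>), so the mean square deviation
on the grid is a combination of two Riemann sums (\<open>grid_mean_deviation\<close>); the dual function
bounds it from below (\<open>grid_mean_deviation_ge\<close>). Monotonicity of $C$ compares these sums with
the two integrals in the right directions, with an error of order $1/n$. As the lower bound does
not deteriorate with $n$, one fine grid suffices; no limit is taken.
\<close>

section \<open>Riemann sums of monotone functions\<close>

lemma mono_riemann_sum_bounds:
  fixes f :: "real \<Rightarrow> real"
  assumes mono: "mono_on {0..1} f" and "n > 0"
  shows "integral {0..1} f \<le> (\<Sum>k=1..n. f (real k / n)) / n"
    and "(\<Sum>k<n. f (real k / n)) / n \<le> integral {0..1} f"
proof -
  note int = integrable_on_mono_on[OF mono]
  have "integral {0..real k / n} f \<le> (\<Sum>i=1..k. f (real i / n)) / n \<and>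
      (\<Sum>i<k. f (real i / n)) / n \<le> integral {0..real k / n} f" if "k \<le> n" for k
    using that
  proof (induction k)
    case 0
    then show ?case by simp
  next
    case (Suc k)
    let ?a = "real k / n" and ?b = "real (Suc k) / n"
    have ab: "0 \<le> ?a" "?a \<le> ?b" "?b \<le> 1" and len: "?b - ?a = 1 / n"
      using Suc.prems \<open>n > 0\<close> by (auto simp: field_simps)
    have fi: "f integrable_on {?a..?b}" "f integrable_on {0..?b}"
      using ab(1,3) by (intro integrable_subinterval_real[OF int] subsetI;
          unfold atLeastAtMost_iff; linarith)+
    have between: "f ?a \<le> f x" "f x \<le> f ?b" if "x \<in> {?a..?b}" for x
    proof -
      have "?a \<le> x" "x \<le> ?b" using that by simp_all
      with ab have "?a \<in> {0..1}" "x \<in> {0..1}" "?b \<in> {0..1}"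
        unfolding atLeastAtMost_iff by linarith+
      with \<open>?a \<le> x\<close> \<open>x \<le> ?b\<close> show "f ?a \<le> f x" "f x \<le> f ?b"
        by (auto intro: mono_onD[OF mono])
    qed
    have "integral {?a..?b} f \<le> integral {?a..?b} (\<lambda>_. f ?b)"
      by (intro integral_le fi between) auto
    moreover have "integral {?a..?b} (\<lambda>_. f ?a) \<le> integral {?a..?b} f"
      by (intro integral_le fi between) auto
    moreover have "integral {0..?a} f + integral {?a..?b} f = integral {0..?b} f"
      using ab by (intro Henstock_Kurzweil_Integration.integral_combine fi)
    ultimately show ?case
      using Suc ab len by (simp add: add_divide_distrib)
  qed
  from this[of n] show "integral {0..1} f \<le> (\<Sum>k=1..n. f (real k / n)) / n"
    "(\<Sum>k<n. f (real k / n)) / n \<le> integral {0..1} f"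
    using \<open>n > 0\<close> by simp_all
qed

section \<open>Monotonicity and continuity of copulas\<close>

lemma copula_volume_nonneg:
  assumes "copula C" "0 \<le> u" "u \<le> u'" "u' \<le> 1" "0 \<le> v" "v \<le> v'" "v' \<le> 1"
  shows "C u' v' - C u' v - C u v' + C u v \<ge> 0"
  using assms unfolding copula_def by blast

lemma copula_boundary:
  assumes "copula C" "t \<in> {0..1}"
  shows "C 0 t = 0" "C t 0 = 0" "C t 1 = t" "C 1 t = t"
  using assms unfolding copula_def by blast+

text \<open>
Both bounds are nonnegativity of a volume: the first for the strip between $u$ and $u'$ below
$v$, the second for the strip above $v$.
\<close>

lemma copula_increment:
  assumes "copula C" "0 \<le> u" "u \<le> u'" "u' \<le> 1" "v \<in> {0..1}"
  shows "C u v \<le> C u' v" "C u' v - C u v \<le> u' - u"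
  using copula_volume_nonneg[OF assms(1), of u u' 0 v] copula_volume_nonneg[OF assms(1), of u u' v 1]
    copula_boundary[OF assms(1), of u] copula_boundary[OF assms(1), of u'] assms by auto

lemma copula_flip:
  assumes "copula C" shows "copula (\<lambda>u v. C v u)"
proof -
  have "C v2 u2 - C v1 u2 - C v2 u1 + C v1 u1 \<ge> 0"
    if "0 \<le> u1 \<and> u1 \<le> u2 \<and> u2 \<le> 1 \<and> 0 \<le> v1 \<and> v1 \<le> v2 \<and> v2 \<le> 1"
    for u1 u2 v1 v2
    using copula_volume_nonneg[OF assms, of v1 v2 u1 u2] that by linarith
  moreover have "\<forall>u\<in>{0..1}. \<forall>v\<in>{0..1}. C v u \<in> {0..1}"
    using assms unfolding copula_def by blast
  ultimately show ?thesis
    unfolding copula_def using copula_boundary[OF assms] by blast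
qed

lemma copula_mono:
  assumes "copula C" "0 \<le> u" "u \<le> u'" "u' \<le> 1" "0 \<le> v" "v \<le> v'" "v' \<le> 1"
  shows "C u v \<le> C u' v'"
  using copula_increment(1)[OF assms(1), of u u' v]
    copula_increment(1)[OF copula_flip[OF assms(1)], of v v' u'] assms by auto

lemma copula_lipschitz:
  assumes "copula C" "u \<in> {0..1}" "u' \<in> {0..1}" "v \<in> {0..1}" "v' \<in> {0..1}"
  shows "\<bar>C u v - C u' v'\<bar> \<le> \<bar>u - u'\<bar> + \<bar>v - v'\<bar>"
proof -
  have one: "\<bar>K a c - K b c\<bar> \<le> \<bar>a - b\<bar>"
    if "copula K" "a \<in> {0..1}" "b \<in> {0..1}" "c \<in> {0..1}" for K a b c
    using copula_increment[OF that(1), of a b c] copula_increment[OF that(1), of b a c] that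
    by (cases "a \<le> b") auto
  show ?thesis
    using one[OF assms(1), of u u' v] one[OF copula_flip[OF assms(1)], of v v' u'] assms by linarith
qed

lemma copula_continuous:
  assumes "copula C"
  shows "continuous_on ({0..1} \<times> {0..1}) (\<lambda>(u, v). C u v)"
proof -
  have "2-lipschitz_on ({0..1} \<times> {0..1}) (\<lambda>(u, v). C u v)"
  proof (rule lipschitz_onI)
    fix x y :: "real \<times> real"
    assume "x \<in> {0..1} \<times> {0..1}" "y \<in> {0..1} \<times> {0..1}"
    then have "dist (case x of (u, v) \<Rightarrow> C u v) (case y of (u, v) \<Rightarrow> C u v)
        \<le> dist (fst x) (fst y) + dist (snd x) (snd y)"
      using copula_lipschitz[OF assms, of "fst x" "fst y" "snd x" "snd y"]
      by (auto simp: dist_real_def case_prod_beta)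
    also have "\<dots> \<le> 2 * dist x y"
      using dist_fst_le[of x y] dist_snd_le[of x y] by simp
    finally show "dist (case x of (u, v) \<Rightarrow> C u v) (case y of (u, v) \<Rightarrow> C u v) \<le> 2 * dist x y" .
  qed simp
  then show ?thesis by (rule lipschitz_on_continuous_on)
qed

section \<open>The distribution of cell masses on a grid\<close>

text \<open>
The mass of the half-open cell with lower left corner $(i/n, j/n)$ and side $1/n$.
\<close>

definition cell_mass :: "(real \<Rightarrow> real \<Rightarrow> real) \<Rightarrow> nat \<Rightarrow> nat \<Rightarrow> nat \<Rightarrow> real" where
  "cell_mass C n i j =
     C (real (Suc i) / n) (real (Suc j) / n) - C (real (Suc i) / n) (real j / n)
     - C (real i / n) (real (Suc j) / n) + C (real i / n) (real j / n)"

definition grid_mean :: "(real \<Rightarrow> real \<Rightarrow> real) \<Rightarrow> nat \<Rightarrow> (nat \<Rightarrow> nat \<Rightarrow> real) \<Rightarrow> real" where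
  "grid_mean C n f = (\<Sum>i<n. \<Sum>j<n. cell_mass C n i j * f i j)"

lemma cell_mass_nonneg: "copula C \<Longrightarrow> i < n \<Longrightarrow> j < n \<Longrightarrow> cell_mass C n i j \<ge> 0"
  unfolding cell_mass_def by (rule copula_volume_nonneg) (auto simp: divide_right_mono)

lemma cell_mass_flip: "cell_mass (\<lambda>u v. C v u) n i j = cell_mass C n j i"
  by (simp add: cell_mass_def)

lemma sum_cell_mass:
  assumes "copula C" "k \<le> n" "l \<le> n"
  shows "(\<Sum>i<k. \<Sum>j<l. cell_mass C n i j) = C (real k / n) (real l / n)"
proof -
  let ?D = "\<lambda>i j. C (real i / n) (real j / n)"
  have z: "?D i 0 = 0" "?D 0 i = 0" if "i \<le> n" for i
    using copula_boundary(1,2)[OF assms(1), of "real i / n"] that by (auto simp: divide_le_eq_1)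
  have "(\<Sum>j<l. cell_mass C n i j) = ?D (Suc i) l - ?D i l" if "i < n" for i
  proof -
    have "(\<Sum>j<l. cell_mass C n i j)
        = (\<Sum>j<l. (?D (Suc i) (Suc j) - ?D i (Suc j)) - (?D (Suc i) j - ?D i j))"
      by (simp add: cell_mass_def algebra_simps)
    also have "\<dots> = (?D (Suc i) l - ?D i l) - (?D (Suc i) 0 - ?D i 0)"
      by (rule sum_lessThan_telescope)
    finally show ?thesis using z(1)[of i] z(1)[of "Suc i"] that by simp
  qed
  then have "(\<Sum>i<k. \<Sum>j<l. cell_mass C n i j) = (\<Sum>i<k. ?D (Suc i) l - ?D i l)"
    using assms by (intro sum.cong) auto
  also have "\<dots> = ?D k l - ?D 0 l" by (rule sum_lessThan_telescope)
  finally show ?thesis using z(2)[of l] assms by simp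
qed

lemma sum_row_cell_mass:
  assumes "copula C" "i < n"
  shows "(\<Sum>j<n. cell_mass C n i j) = 1 / n"
proof -
  have "(\<Sum>j<n. cell_mass C n i j)
      = (\<Sum>i<Suc i. \<Sum>j<n. cell_mass C n i j) - (\<Sum>i<i. \<Sum>j<n. cell_mass C n i j)"
    by simp
  also have "\<dots> = C (real (Suc i) / n) 1 - C (real i / n) 1"
    using assms by (subst (1 2) sum_cell_mass) auto
  also have "\<dots> = real (Suc i) / n - real i / n"
    using assms(2) by (simp add: copula_boundary(3)[OF assms(1)])
  finally show ?thesis by (simp add: diff_divide_distrib[symmetric])
qed

lemma grid_mean_fst:
  assumes "copula C" shows "grid_mean C n (\<lambda>i j. f i) = (\<Sum>i<n. f i) / n"
  unfolding grid_mean_def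
  by (simp add: sum_distrib_right[symmetric] sum_row_cell_mass[OF assms] sum_divide_distrib)

lemma grid_mean_flip: "grid_mean (\<lambda>u v. C v u) n f = grid_mean C n (\<lambda>i j. f j i)"
  unfolding grid_mean_def cell_mass_flip[of C] by (rule sum.swap)

lemma grid_mean_snd:
  assumes "copula C" shows "grid_mean C n (\<lambda>i j. f j) = (\<Sum>i<n. f i) / n"
  using grid_mean_fst[OF copula_flip[OF assms]] by (simp add: grid_mean_flip[of C])

lemma grid_mean_add: "grid_mean C n (\<lambda>i j. f i j + g i j) = grid_mean C n f + grid_mean C n g"
  by (simp add: grid_mean_def sum.distrib algebra_simps)

lemma grid_mean_cmult: "grid_mean C n (\<lambda>i j. c * f i j) = c * grid_mean C n f"
  by (simp add: grid_mean_def sum_distrib_left algebra_simps)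

lemma grid_mean_sum: "grid_mean C n (\<lambda>i j. \<Sum>k\<in>A. f k i j) = (\<Sum>k\<in>A. grid_mean C n (f k))"
  by (induction A rule: infinite_finite_induct)
    (simp_all add: grid_mean_add, simp_all add: grid_mean_def)

lemma grid_mean_mono:
  assumes "copula C" "\<And>i j. i < n \<Longrightarrow> j < n \<Longrightarrow> f i j \<le> g i j"
  shows "grid_mean C n f \<le> grid_mean C n g"
  unfolding grid_mean_def using assms by (intro sum_mono mult_left_mono cell_mass_nonneg) auto

lemma grid_mean_cong:
  assumes "\<And>i j. i < n \<Longrightarrow> j < n \<Longrightarrow> f i j = g i j"
  shows "grid_mean C n f = grid_mean C n g"
  unfolding grid_mean_def using assms by (intro sum.cong) auto

text \<open>
The bridge between expectations and values of $C$: any function of $(i,j)$ that is a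
combination of indicators of lower left quadrants has a mean that can be read off from $C$ at
grid points.
\<close>

lemma grid_mean_quadrant:
  assumes "copula C" "k \<le> n" "l \<le> n"
  shows "grid_mean C n (\<lambda>i j. of_bool (i < k) * of_bool (j < l)) = C (real k / n) (real l / n)"
proof -
  have cut: "(\<Sum>i<n. of_bool (i < k) * h i) = (\<Sum>i<k. h i)" if "k \<le> n" for k and h :: "nat \<Rightarrow> real"
    using that by (intro sum.mono_neutral_cong_right) auto
  have "grid_mean C n (\<lambda>i j. of_bool (i < k) * of_bool (j < l))
      = (\<Sum>i<n. of_bool (i < k) * (\<Sum>j<n. of_bool (j < l) * cell_mass C n i j))"
    unfolding grid_mean_def by (simp only: sum_distrib_left mult_ac)
  then show ?thesis by (simp only: cut[OF assms(2)] cut[OF assms(3)] sum_cell_mass[OF assms])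
qed

text \<open>
Layer-cake formula for $n - i$, which makes $(n-i)(n-j)$ and $n - \max(i,j)$ sums of
quadrant indicators. Reflecting the indices in this way avoids upper right quadrants, whose
masses involve the marginals.
\<close>

lemma sum_of_bool_less:
  assumes "i \<le> n" shows "(\<Sum>k=1..n. of_bool (i < k)) = real n - real i"
proof -
  have "{1..n} \<inter> {k. i < k} = {i<..n}" by auto
  then show ?thesis using assms by (simp add: sum.inter_restrict[symmetric] of_bool_def of_nat_diff
      sum.If_cases)
qed

lemma grid_mean_prod:
  assumes "copula C"
  shows "grid_mean C n (\<lambda>i j. (real n - real i) * (real n - real j))
      = (\<Sum>k=1..n. \<Sum>l=1..n. C (real k / n) (real l / n))"
proof -
  have "grid_mean C n (\<lambda>i j. (real n - real i) * (real n - real j))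
      = grid_mean C n (\<lambda>i j. \<Sum>k=1..n. \<Sum>l=1..n. of_bool (i < k) * of_bool (j < l))"
    by (intro grid_mean_cong) (simp only: sum_product[symmetric] sum_of_bool_less less_imp_le)
  then show ?thesis
    unfolding grid_mean_sum by (auto intro!: sum.cong grid_mean_quadrant[OF assms] elim!: trans)
qed

lemma grid_mean_max:
  assumes "copula C"
  shows "grid_mean C n (\<lambda>i j. real n - real (max i j)) = (\<Sum>k=1..n. C (real k / n) (real k / n))"
proof -
  have "grid_mean C n (\<lambda>i j. real n - real (max i j))
      = grid_mean C n (\<lambda>i j. \<Sum>k=1..n. of_bool (i < k) * of_bool (j < k))"
  proof (rule grid_mean_cong)
    fix i j assume "i < n" "j < n"
    then show "real n - real (max i j) = (\<Sum>k=1..n. of_bool (i < k) * of_bool (j < k))"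
      using sum_of_bool_less[of "max i j" n] by (simp only: of_bool_conj[symmetric] max_less_iff_conj)
  qed
  then show ?thesis
    unfolding grid_mean_sum by (auto intro!: sum.cong grid_mean_quadrant[OF assms] elim!: trans)
qed

section \<open>The mean square deviation in terms of grid sums\<close>

lemma sum_reflect: "(\<Sum>i<n. real n - real i) = real n * (real n + 1) / 2"
proof -
  have "2 * (\<Sum>i<k. N - real i) = 2 * real k * N - real k * (real k - 1)" for k and N :: real
    by (induction k) (auto simp: algebra_simps)
  from this[where k = n and N = "real n"] show ?thesis by (simp add: algebra_simps)
qed

lemma sum_reflect_sq:
  "(\<Sum>i<n. (real n - real i)\<^sup>2) = real n * (real n + 1) * (2 * real n + 1) / 6"
proof -
  have "6 * (\<Sum>i<k. (N - real i)\<^sup>2)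
      = 6 * real k * N\<^sup>2 - 6 * N * real k * (real k - 1) + real k * (real k - 1) * (2 * real k - 1)"
    for k and N :: real
    by (induction k) (auto simp: algebra_simps power2_eq_square)
  from this[where k = n and N = "real n"] show ?thesis
    by (simp add: algebra_simps power2_eq_square)
qed

text \<open>
With $x = n - i$ and $y = n - j$, expand $(|x-y| - c)^2 = x^2 + y^2 - 2xy - 2c|x-y| + c^2$ and
write $|x-y| = x + y - 2\min(x,y)$, where $\min(x,y) = n - \max(i,j)$. The moments of $x$ and $y$
alone are those of uniform marginals; only $xy$ and $\min(x,y)$ depend on the copula.
\<close>

lemma grid_mean_deviation:
  assumes "copula C" "n > 0"
  shows "grid_mean C n (\<lambda>i j. (\<bar>real i - real j\<bar> - c)\<^sup>2)
      = (real n + 1) * (2 * real n + 1) / 3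
        - 2 * (\<Sum>k=1..n. \<Sum>l=1..n. C (real k / n) (real l / n))
        - 2 * c * (real n + 1) + 4 * c * (\<Sum>k=1..n. C (real k / n) (real k / n)) + c\<^sup>2"
proof -
  have "(\<Sum>i<n. (real n - real i)\<^sup>2 - 2 * c * (real n - real i))
      = real n * (real n + 1) * (2 * real n + 1) / 6 - 2 * c * (real n * (real n + 1) / 2)"
    by (simp only: sum_subtractf[of "\<lambda>i. (real n - real i)\<^sup>2" "\<lambda>i. 2 * c * (real n - real i)"]
        sum_distrib_left[symmetric] sum_reflect sum_reflect_sq)
  then have marginal: "(\<Sum>i<n. (real n - real i)\<^sup>2 - 2 * c * (real n - real i)) / n
      = (real n + 1) * (2 * real n + 1) / 6 - c * (real n + 1)"
    using assms(2) by (simp add: field_simps)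
  have "grid_mean C n (\<lambda>i j. (\<bar>real i - real j\<bar> - c)\<^sup>2)
     = grid_mean C n (\<lambda>i j. ((real n - real i)\<^sup>2 - 2 * c * (real n - real i) + c\<^sup>2)
         + (((real n - real j)\<^sup>2 - 2 * c * (real n - real j))
         + ((-2) * ((real n - real i) * (real n - real j)) + 4 * c * (real n - real (max i j)))))"
    by (rule grid_mean_cong) (auto simp: max_def power2_eq_square algebra_simps abs_if)
  also have "\<dots> = (\<Sum>i<n. (real n - real i)\<^sup>2 - 2 * c * (real n - real i) + c\<^sup>2) / n
      + ((\<Sum>i<n. (real n - real i)\<^sup>2 - 2 * c * (real n - real i)) / n
      + ((-2) * (\<Sum>k=1..n. \<Sum>l=1..n. C (real k / n) (real l / n))
      + 4 * c * (\<Sum>k=1..n. C (real k / n) (real k / n))))"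
    by (simp only: grid_mean_add grid_mean_cmult grid_mean_fst[OF assms(1)]
        grid_mean_snd[OF assms(1)] grid_mean_prod[OF assms(1)] grid_mean_max[OF assms(1)]
        sum.distrib add_divide_distrib)
  also have "(\<Sum>i<n. (real n - real i)\<^sup>2 - 2 * c * (real n - real i) + c\<^sup>2) / n
      = (real n + 1) * (2 * real n + 1) / 6 - c * (real n + 1) + c\<^sup>2"
    using assms(2) by (simp only: sum.distrib add_divide_distrib marginal) simp
  also note marginal
  finally show ?thesis by (simp add: algebra_simps)
qed

section \<open>A dual certificate for the distance from one third\<close>

text \<open>
The dual function $a$ on a grid of $24m$ points, divided by $\varepsilon$: one third is $8m$
points long and a margin is $m$ points wide.
\<close>

definition dual_weight :: "nat \<Rightarrow> nat \<Rightarrow> real" where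
  "dual_weight m i =
     of_bool (i \<in> {m..<7 * m} \<union> {17 * m..<23 * m}) - of_bool (i \<in> {8 * m..<16 * m})"

lemma sum_dual_weight: "(\<Sum>i<24 * m. dual_weight m i) = 4 * real m"
proof -
  have cnt: "(\<Sum>i<24 * m. of_bool (i \<in> A)) = real (card A)" if "A \<subseteq> {..<24*m}" for A
    using that by (simp add: Int_absorb1)
  have "(\<Sum>i<24 * m. dual_weight m i)
     = real (card ({m..<7 * m} \<union> {17 * m..<23 * m})) - real (card {8 * m..<16 * m})"
    unfolding dual_weight_def sum_subtractf by (intro arg_cong2[where f = "(-)"] cnt) auto
  also have "card ({m..<7 * m} \<union> {17 * m..<23 * m}) = 12 * m"
    by (subst card_Un_disjoint) auto
  finally show ?thesis by simp
qed

text \<open>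
Only pairs with a positive sum of weights matter. If one point has weight $1$ and the other has
weight $0$, they lie in the same outer third, at distance at most $7m$, or in opposite ones, at
distance at least $9m$. If both have weight $1$, the gap to $8m$ is at least $2m$, and the sum
of weights is $2 \le 2^2$.
\<close>

lemma dual_weight_le:
  assumes "i < 24 * m" "j < 24 * m"
  shows "(real m)\<^sup>2 * (dual_weight m i + dual_weight m j) \<le> (\<bar>real i - real j\<bar> - 8 * real m)\<^sup>2"
proof -
  let ?d = "\<bar>real i - real j\<bar> - 8 * real m"
  have sq: "(c * real m)\<^sup>2 \<le> ?d\<^sup>2" if "c * real m \<le> \<bar>?d\<bar>" "0 \<le> c" for c
    using power_mono[OF that(1), of 2] that(2) by simp
  consider "dual_weight m i + dual_weight m j \<le> 0"
    | "dual_weight m i + dual_weight m j \<le> 1" "1 * real m \<le> \<bar>?d\<bar>"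
    | "dual_weight m i + dual_weight m j \<le> 2" "2 * real m \<le> \<bar>?d\<bar>"
  proof -
    \<comment> \<open>Casting the bounds to the reals makes the case distinction linear real arithmetic. Weight $-1$
      comes without bounds because it makes the sum nonpositive for any partner.\<close>
    have cl: "dual_weight m k = 1 \<and>
          (real m \<le> real k \<and> real k < 7 * real m \<or> 17 * real m \<le> real k \<and> real k < 23 * real m)
        \<or> dual_weight m k = 0 \<and> (real k < 8 * real m \<or> 16 * real m \<le> real k)
        \<or> dual_weight m k = -1" for k
    proof -
      have *: "(m \<le> k \<and> k < 7 * m \<or> 17 * m \<le> k \<and> k < 23 * m) \<longleftrightarrow>
          (real m \<le> real k \<and> real k < 7 * real m \<or> 17 * real m \<le> real k \<and> real k < 23 * real m)"
        "(k < 8 * m \<or> 16 * m \<le> k) \<longleftrightarrow> (real k < 8 * real m \<or> 16 * real m \<le> real k)"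
        by linarith+
      show ?thesis unfolding *[symmetric] dual_weight_def by (auto simp: of_bool_def)
    qed
    have "real i < 24 * real m" "real j < 24 * real m" "0 \<le> real i" "0 \<le> real j"
      using assms by linarith+
    then show ?thesis using cl[of i] cl[of j] that by (smt (verit))
  qed
  then show ?thesis
  proof cases
    case 1
    then show ?thesis by (smt (verit) mult_nonneg_nonpos zero_le_power2)
  next
    case 2
    then have "(real m)\<^sup>2 * (dual_weight m i + dual_weight m j) \<le> (real m)\<^sup>2 * 1"
      by (intro mult_left_mono) auto
    then show ?thesis using sq[OF 2(2)] by simp
  next
    case 3
    then have "(real m)\<^sup>2 * (dual_weight m i + dual_weight m j) \<le> (real m)\<^sup>2 * 4"
      by (intro mult_left_mono) auto
    then show ?thesis using sq[OF 3(2)] by (simp add: power_mult_distrib)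
  qed
qed

text \<open>
Duality: a mean of $w_i + w_j$ only sees the uniform marginals, so this bound holds for every
copula. In units of the grid, $m^2/3$ is the $1/1728$ of the continuous estimate.
\<close>

lemma grid_mean_deviation_ge:
  assumes "copula C" "m > 0"
  shows "(real m)\<^sup>2 / 3 \<le> grid_mean C (24 * m) (\<lambda>i j. (\<bar>real i - real j\<bar> - 8 * real m)\<^sup>2)"
proof -
  have "(real m)\<^sup>2 / 3
      = grid_mean C (24 * m) (\<lambda>i j. (real m)\<^sup>2 * (dual_weight m i + dual_weight m j))"
    using assms(2) by (simp add: grid_mean_cmult grid_mean_add grid_mean_fst[OF assms(1)]
        grid_mean_snd[OF assms(1)] sum_dual_weight)
  also have "\<dots> \<le> grid_mean C (24 * m) (\<lambda>i j. (\<bar>real i - real j\<bar> - 8 * real m)\<^sup>2)"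
    by (intro grid_mean_mono[OF assms(1)] dual_weight_le)
  finally show ?thesis .
qed

section \<open>Comparing the grid sums with the integrals\<close>

lemma integral_copula_le_sum:
  assumes "copula C" "n > 0"
  shows "(real n)\<^sup>2 * integral ({0..1} \<times> {0..1}) (\<lambda>(u, v). C u v)
      \<le> (\<Sum>k=1..n. \<Sum>l=1..n. C (real k / n) (real l / n))"
proof -
  let ?G = "\<lambda>u. integral {0..1} (C u)"
  have mono_v: "mono_on {0..1} (C u)" if "u \<in> {0..1}" for u
    using that by (intro mono_onI copula_mono[OF assms(1)]) auto
  note int_v = integrable_on_mono_on[OF mono_v]
  have mono_u: "mono_on {0..1} ?G"
    by (intro mono_onI integral_le int_v) (auto intro!: copula_mono[OF assms(1)])
  have "integral ({0..1} \<times> {0..1}) (\<lambda>(u, v). C u v) = integral {0..1} ?G"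
    using integral_prod_continuous[of "0::real" "0::real" "1::real" "1::real" "\<lambda>(u, v). C u v"]
      copula_continuous[OF assms(1)] by (simp add: cbox_Pair_eq)
  also have "\<dots> \<le> (\<Sum>k=1..n. ?G (real k / n)) / n"
    by (rule mono_riemann_sum_bounds[OF mono_u assms(2)])
  also have "\<dots> \<le> (\<Sum>k=1..n. (\<Sum>l=1..n. C (real k / n) (real l / n)) / n) / n"
    by (intro divide_right_mono sum_mono mono_riemann_sum_bounds mono_v)
      (use assms(2) in auto)
  finally show ?thesis
    using assms(2) by (simp add: sum_divide_distrib[symmetric] field_simps power2_eq_square)
qed

text \<open>
The diagonal sum enters the deviation with a positive coefficient and has to be bounded from
above, although it is the upper Riemann sum. It exceeds the lower sum by the last term
$C(1,1) = 1$ only, since $C(0,0) = 0$.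
\<close>

lemma sum_diagonal_le_integral:
  assumes "copula C" "n > 0"
  shows "(\<Sum>k=1..n. C (real k / n) (real k / n)) \<le> n * integral {0..1} (\<lambda>u. C u u) + 1"
proof -
  let ?d = "\<lambda>k. C (real k / n) (real k / n)"
  have mono: "mono_on {0..1} (\<lambda>u. C u u)"
    by (intro mono_onI copula_mono[OF assms(1)]) auto
  have "(\<Sum>k=1..n. ?d k) = (\<Sum>k<n. ?d (Suc k))"
    using sum.atLeast1_atMost_eq[of ?d n] by simp
  also have "\<dots> = (\<Sum>k<n. ?d k) + 1"
    using sum_lessThan_telescope[of ?d n] assms copula_boundary[OF assms(1), of 1]
      copula_boundary[OF assms(1), of 0]
    by (simp add: sum_subtractf)
  also have "(\<Sum>k<n. ?d k) \<le> n * integral {0..1} (\<lambda>u. C u u)"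
    using mono_riemann_sum_bounds(2)[OF mono assms(2)] assms(2)
    by (simp add: field_simps)
  finally show ?thesis by simp
qed

section \<open>The strict bound on Spearman's rho\<close>

theorem proposition12:
  fixes C :: "real \<Rightarrow> real \<Rightarrow> real"
  assumes "copula C"
    and "spearman_footrule C = 0"
  shows "spearman_rho C < 1 / 3"
proof -
  \<comment> \<open>The certificate lowers the bound $5/18$ on the integral of $C$ by $1/3456$ and the Riemann sums
    cost at most $1/n$, so $n = 24m > 3456$ is fine enough.\<close>
  define m n :: nat where "m = 145" and "n = 24 * m"
  define I where "I = integral ({0..1} \<times> {0..1}) (\<lambda>(u, v). C u v)"
  have n: "n > 0" "real n = 3480" "real m = 145"
    by (simp_all add: n_def m_def)
  have J: "integral {0..1} (\<lambda>u. C u u) = 1 / 3"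
    using assms(2) by (simp add: spearman_footrule_def)
  have diag: "(\<Sum>k=1..n. C (real k / n) (real k / n)) \<le> real n / 3 + 1"
    using sum_diagonal_le_integral[OF assms(1) n(1)] unfolding J by simp
  have "(real n)\<^sup>2 * I \<le> (\<Sum>k=1..n. \<Sum>l=1..n. C (real k / n) (real l / n))"
    unfolding I_def by (rule integral_copula_le_sum[OF assms(1) n(1)])
  moreover have "(real m)\<^sup>2 / 3 \<le> grid_mean C n (\<lambda>i j. (\<bar>real i - real j\<bar> - 8 * real m)\<^sup>2)"
    unfolding n_def by (rule grid_mean_deviation_ge[OF assms(1)]) (simp add: m_def)
  ultimately have "(real m)\<^sup>2 / 3 \<le> (real n + 1) * (2 * real n + 1) / 3 - 2 * ((real n)\<^sup>2 * I)
      - 16 * real m * (real n + 1) + 32 * real m * (real n / 3 + 1) + 64 * (real m)\<^sup>2"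
    using mult_left_mono[OF diag, of "32 * real m"]
    unfolding grid_mean_deviation[OF assms(1) n(1)] by (simp add: power_mult_distrib)
  then have "I < 5 / 18"
    unfolding n by simp
  then show ?thesis
    by (simp add: spearman_rho_def I_def)
qed

end
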